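(* Let $X$ and $Y$ be two topological spaces, $T:X\rightrightarrows Y$ a correspondence and $f:X\times Y\to\mathbb{R}$ a function. If $f$ is pseudo-continuous (on the product space $X\times Y$) and $T$ is continuous with non-empty and compact values, then the argmax correspondence $M:X\rightrightarrows Y$ defined by \[ M(x)=\{y\in T(x): f(x,y)=m(x)\} \] is upper hemicontinuous, and the value function $m$ defined by \[ m(x)=\max_{y\in T(x)} f(x,y) \] is real-valued and pseudo-continuous on $X$.
   Context: A function $f:Z\to\mathbb{R}$ on a topological space $Z$ is upper pseudo-continuous if for all $x,y\in Z$ with $f(x)<f(y)$ there is a neighbourhood $V$ of $x$ with $f(x')<f(y)$ for all $x'\in V$. It is lower pseudo-continuous if $-f$ is upper pseudo-continuous, and pseudo-continuous if it is both upper and lower pseudo-continuous. A correspondence $T:X\rightrightarrows Y$ is a map assigning to each $x\in X$ a subset $T(x)\subset Y$. It is lower hemicontinuous if for all $x\in X$ and every open $V\subset Y$ with $T(x)\cap V\neq\emptyset$ there is a neighbourhood $W$ of $x$ such that $T(x')\cap V\neq\emptyset$ for all $x'\in W$. It is upper hemicontinuous if for all $x\in X$ and every open $V\subset Y$ with $T(x)\subset V$ there is a neighbourhood $W$ of $x$ such that $T(x')\subset V$ for all $x'\in W$. It is continuous if it is both upper and lower hemicontinuous. *)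

theory Defs
  imports "HOL-Analysis.Analysis"
begin

text \<open>
  A neighbourhood of a point on which a property holds is expressed with the neighbourhood
  filter \<^const>\<open>nhds\<close>: \<open>\<forall>\<^sub>F x' in nhds x. P x'\<close> holds iff \<open>P\<close> holds on some open set containing \<open>x\<close>
  (the point \<open>x\<close> itself included).
\<close>

definition upper_pseudo_continuous :: "('z::topological_space \<Rightarrow> real) \<Rightarrow> bool" where
  "upper_pseudo_continuous f \<longleftrightarrow>
     (\<forall>x y. f x < f y \<longrightarrow> (\<forall>\<^sub>F x' in nhds x. f x' < f y))"

definition lower_pseudo_continuous :: "('z::topological_space \<Rightarrow> real) \<Rightarrow> bool" where
  "lower_pseudo_continuous f \<longleftrightarrow> upper_pseudo_continuous (\<lambda>z. - f z)"

definition pseudo_continuous :: "('z::topological_space \<Rightarrow> real) \<Rightarrow> bool" where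
  "pseudo_continuous f \<longleftrightarrow> upper_pseudo_continuous f \<and> lower_pseudo_continuous f"

definition lower_hemicontinuous ::
  "('x::topological_space \<Rightarrow> 'y::topological_space set) \<Rightarrow> bool" where
  "lower_hemicontinuous T \<longleftrightarrow>
     (\<forall>x V. open V \<longrightarrow> T x \<inter> V \<noteq> {} \<longrightarrow> (\<forall>\<^sub>F x' in nhds x. T x' \<inter> V \<noteq> {}))"

definition upper_hemicontinuous ::
  "('x::topological_space \<Rightarrow> 'y::topological_space set) \<Rightarrow> bool" where
  "upper_hemicontinuous T \<longleftrightarrow>
     (\<forall>x V. open V \<longrightarrow> T x \<subseteq> V \<longrightarrow> (\<forall>\<^sub>F x' in nhds x. T x' \<subseteq> V))"

definition continuous_correspondence ::
  "('x::topological_space \<Rightarrow> 'y::topological_space set) \<Rightarrow> bool" where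
  "continuous_correspondence T \<longleftrightarrow> upper_hemicontinuous T \<and> lower_hemicontinuous T"

text \<open>
  \<^const>\<open>Max\<close> is meaningful only for finite sets, so the maximum over \<open>T x\<close> is written with
  \<^const>\<open>Greatest\<close>.  It is a total function; that the maximum really exists (so that the value
  function is well defined and real-valued) is a separate claim, \<open>attains_max\<close>.
\<close>

definition value_function :: "('x \<Rightarrow> 'y set) \<Rightarrow> ('x \<times> 'y \<Rightarrow> real) \<Rightarrow> 'x \<Rightarrow> real" where
  "value_function T f x = (GREATEST r. r \<in> (\<lambda>y. f (x, y)) ` T x)"

definition attains_max :: "('x \<Rightarrow> 'y set) \<Rightarrow> ('x \<times> 'y \<Rightarrow> real) \<Rightarrow> 'x \<Rightarrow> bool" where
  "attains_max T f x \<longleftrightarrow> (\<exists>y\<in>T x. \<forall>y'\<in>T x. f (x, y') \<le> f (x, y))"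

definition argmax_correspondence ::
  "('x \<Rightarrow> 'y set) \<Rightarrow> ('x \<times> 'y \<Rightarrow> real) \<Rightarrow> 'x \<Rightarrow> 'y set" where
  "argmax_correspondence T f x = {y \<in> T x. f (x, y) = value_function T f x}"

end

theory Submission
  imports Defs
begin

text \<open>
  This is Berge's maximum theorem with continuity of \<open>f\<close> weakened to pseudo-continuity: \<open>f\<close> may
  be compared with its own values near a point, but not with arbitrary real levels.  The proof
  therefore has to use only thresholds that \<open>f\<close> attains.

  Three principles carry it.  Along a lower hemicontinuous correspondence, a property holding near
  a point of the graph still holds at some point of every nearby value
  (\<open>lower_hemicontinuous_eventually_Bex\<close>).  Along an upper hemicontinuous correspondence with
  compact values, a property holding near every point of \<open>T x - V\<close> holds on all of \<open>T x' - V\<close> for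
  \<open>x'\<close> near \<open>x\<close> (\<open>upper_hemicontinuous_eventually_Ball\<close>, by the tube lemma).  Finally,
  pseudo-continuity makes a strict inequality \<open>f p < f q\<close> stable under moving \<open>p\<close> and \<open>q\<close>
  simultaneously (\<open>pseudo_continuous_less_stable\<close>), although the definition moves only one of them.

  Maxima exist, so every \<open>m x\<close> is itself a value of \<open>f\<close> and hence an admissible threshold.  The
  second principle with \<open>V = {}\<close> then gives upper pseudo-continuity of \<open>m\<close>, and the first gives
  lower pseudo-continuity.  For the argmax, let \<open>V\<close> be open with \<open>M x \<subseteq> V\<close>.  Each point
  of \<open>T x - V\<close> is strictly worse than a fixed maximiser.  By stability and the first principle,
  points near it stay strictly below \<open>m x'\<close> for \<open>x'\<close> near \<open>x\<close>, so the second principle excludes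
  maximisers outside \<open>V\<close>.
\<close>

section \<open>Pseudo-continuous functions\<close>

lemma lower_pseudo_continuousD:
  assumes "lower_pseudo_continuous f" and "f x < f y"
  shows "\<forall>\<^sub>F y' in nhds y. f x < f y'"
  using assms by (auto simp: lower_pseudo_continuous_def upper_pseudo_continuous_def)

text \<open>
  If some value \<open>f r\<close> lies strictly between \<open>f p\<close> and \<open>f q\<close>, it separates them.  If no value does,
  the bound \<open>f p' < f q\<close> already forces \<open>f p' \<le> f p\<close>, and \<open>f p < f q'\<close> holds near \<open>q\<close>.
\<close>

lemma pseudo_continuous_less_stable:
  assumes "pseudo_continuous f" and "f p < f q"
  shows "\<forall>\<^sub>F (p', q') in nhds p \<times>\<^sub>F nhds q. f p' < f q'"
proof -
  have upper: "\<forall>\<^sub>F p' in nhds p. f p' < f r" if "f p < f r" for r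
    using assms(1) that by (simp add: pseudo_continuous_def upper_pseudo_continuous_def)
  have lower: "\<forall>\<^sub>F q' in nhds q. f r < f q'" if "f r < f q" for r
    using assms(1) that lower_pseudo_continuousD by (auto simp: pseudo_continuous_def)
  show ?thesis
  proof (cases "\<exists>r. f p < f r \<and> f r < f q")
    case True
    then obtain r where r: "f p < f r" "f r < f q" by blast
    show ?thesis
      unfolding eventually_prod_filter case_prod_conv
      using upper[OF r(1)] lower[OF r(2)] less_trans by blast
  next
    case False
    then have "f p' \<le> f p" if "f p' < f q" for p'
      using that not_less by blast
    then show ?thesis
      unfolding eventually_prod_filter case_prod_conv
      using upper[OF assms(2)] lower[OF assms(2)] le_less_trans by blast
  qed
qed

text \<open>
  Weierstrass' theorem needs only upper pseudo-continuity: were there no maximum, the sets on which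
  \<open>g\<close> is below one of its values \<open>g z\<close> would cover \<open>K\<close>, but finitely many of them miss the best of
  their finitely many points \<open>z\<close>.
\<close>

lemma upper_pseudo_continuous_attains_sup:
  assumes "upper_pseudo_continuous g" and "compact K" and "K \<noteq> {}"
  shows "\<exists>y\<in>K. \<forall>y'\<in>K. g y' \<le> g y"
proof (rule ccontr)
  assume "\<not> ?thesis"
  then have ex: "\<exists>z\<in>K. g y < g z" if "y \<in> K" for y
    using that not_le by blast
  define U where "U z = interior {y. g y < g z}" for z
  have "K \<subseteq> (\<Union>z\<in>K. U z)"
  proof
    fix y assume "y \<in> K"
    then obtain z where z: "z \<in> K" "g y < g z" using ex by blast
    then have "\<forall>\<^sub>F y' in nhds y. g y' < g z"
      using assms(1) by (simp add: upper_pseudo_continuous_def)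
    then have "y \<in> U z"
      by (auto simp: U_def eventually_nhds interior_def)
    then show "y \<in> (\<Union>z\<in>K. U z)" using z by blast
  qed
  then obtain F where F: "F \<subseteq> K" "finite F" "K \<subseteq> (\<Union>z\<in>F. U z)"
    using compactE_image[OF assms(2), of K U] by (auto simp: U_def)
  then have "finite (g ` F)" "g ` F \<noteq> {}" using assms(3) by auto
  then have "Max (g ` F) \<in> g ` F" by (rule Max_in)
  then obtain w where w: "w \<in> F" "g w = Max (g ` F)" by auto
  then obtain z where z: "z \<in> F" "w \<in> U z" using F by blast
  then have "g w < g z" using interior_subset by (auto simp: U_def)
  moreover have "g z \<le> g w" using w z F by simp
  ultimately show False by simp
qed

lemma upper_pseudo_continuous_section:
  assumes "upper_pseudo_continuous f"
  shows "upper_pseudo_continuous (\<lambda>y. f (x, y))"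
  unfolding upper_pseudo_continuous_def
proof (intro allI impI)
  fix y z assume "f (x, y) < f (x, z)"
  then have "\<forall>\<^sub>F p in nhds (x, y). f p < f (x, z)"
    using assms by (simp add: upper_pseudo_continuous_def)
  then show "\<forall>\<^sub>F y' in nhds y. f (x, y') < f (x, z)"
    unfolding nhds_prod eventually_prod_filter
    by (metis (mono_tags, lifting) eventually_mono eventually_nhds_x_imp_x)
qed

section \<open>Properties near the graph of a correspondence\<close>

text \<open>
  The tube lemma for neighbourhood filters: finitely many rectangles cover \<open>{x} \<times> K\<close>, and their
  finitely many first sides intersect in a neighbourhood of \<open>x\<close>.
\<close>

lemma compact_tube:
  assumes "compact K" and "\<And>y. y \<in> K \<Longrightarrow> \<forall>\<^sub>F p in nhds (x, y). P p"
  obtains U where "open U" "K \<subseteq> U" "\<forall>\<^sub>F x' in nhds x. \<forall>y'\<in>U. P (x', y')"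
proof -
  have "\<exists>U. open U \<and> y \<in> U \<and> (\<forall>\<^sub>F x' in nhds x. \<forall>y'\<in>U. P (x', y'))" if y: "y \<in> K" for y
  proof -
    obtain A B where AB: "\<forall>\<^sub>F x' in nhds x. A x'" "\<forall>\<^sub>F y' in nhds y. B y'"
        "\<And>x' y'. A x' \<Longrightarrow> B y' \<Longrightarrow> P (x', y')"
      using assms(2)[OF y] unfolding nhds_prod eventually_prod_filter by blast
    obtain U where "open U" "y \<in> U" "\<And>y'. y' \<in> U \<Longrightarrow> B y'"
      using AB(2) unfolding eventually_nhds by blast
    moreover have "\<forall>\<^sub>F x' in nhds x. \<forall>y'\<in>U. P (x', y')"
      using AB(1) by eventually_elim (use AB(3) calculation in blast)
    ultimately show ?thesis by blast
  qed
  then obtain U where U: "\<And>y. y \<in> K \<Longrightarrow> open (U y)" "\<And>y. y \<in> K \<Longrightarrow> y \<in> U y"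
      "\<And>y. y \<in> K \<Longrightarrow> \<forall>\<^sub>F x' in nhds x. \<forall>y'\<in>U y. P (x', y')"
    by metis
  obtain F where F: "F \<subseteq> K" "finite F" "K \<subseteq> (\<Union>y\<in>F. U y)"
    using compactE_image[OF assms(1), of K U] U(1,2) by blast
  show thesis
  proof (rule that)
    show "open (\<Union>y\<in>F. U y)" using F U(1) by blast
    have "\<forall>\<^sub>F x' in nhds x. \<forall>y\<in>F. \<forall>y'\<in>U y. P (x', y')"
      using F U(3) by (intro eventually_ball_finite) auto
    then show "\<forall>\<^sub>F x' in nhds x. \<forall>y'\<in>(\<Union>y\<in>F. U y). P (x', y')"
      by eventually_elim blast
  qed (use F in blast)
qed

text \<open>
  The open set \<open>V\<close> is where nothing is required.  A tube around the compact set \<open>T x - V\<close> together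
  with \<open>V\<close> is an open set containing \<open>T x\<close>, hence nearby values.
\<close>

lemma upper_hemicontinuous_eventually_Ball:
  assumes "upper_hemicontinuous T" and "compact (T x)" and "open V"
    and "\<And>y. y \<in> T x - V \<Longrightarrow> \<forall>\<^sub>F p in nhds (x, y). P p"
  shows "\<forall>\<^sub>F x' in nhds x. \<forall>y'\<in>T x' - V. P (x', y')"
proof -
  have "compact (T x - V)" using assms(2,3) by (rule compact_diff)
  then obtain U where U: "open U" "T x - V \<subseteq> U" "\<forall>\<^sub>F x' in nhds x. \<forall>y'\<in>U. P (x', y')"
    using compact_tube[of "T x - V" P x] assms(4) by blast
  have "T x \<subseteq> U \<union> V" using U(2) by blast
  then have "\<forall>\<^sub>F x' in nhds x. T x' \<subseteq> U \<union> V"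
    using assms(1,3) U(1) by (simp add: upper_hemicontinuous_def open_Un)
  with U(3) show ?thesis by eventually_elim blast
qed

lemma lower_hemicontinuous_eventually_Bex:
  assumes "lower_hemicontinuous T" and "y \<in> T x" and "\<forall>\<^sub>F p in nhds (x, y). P p"
  shows "\<forall>\<^sub>F x' in nhds x. \<exists>y'\<in>T x'. P (x', y')"
proof -
  obtain A B where AB: "\<forall>\<^sub>F x' in nhds x. A x'" "\<forall>\<^sub>F y' in nhds y. B y'"
      "\<And>x' y'. A x' \<Longrightarrow> B y' \<Longrightarrow> P (x', y')"
    using assms(3) unfolding nhds_prod eventually_prod_filter by blast
  obtain V where V: "open V" "y \<in> V" "\<And>y'. y' \<in> V \<Longrightarrow> B y'"
    using AB(2) unfolding eventually_nhds by blast
  then have "T x \<inter> V \<noteq> {}" using assms(2) by blast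
  then have "\<forall>\<^sub>F x' in nhds x. T x' \<inter> V \<noteq> {}"
    using assms(1) V(1) by (simp add: lower_hemicontinuous_def)
  with AB(1) show ?thesis by eventually_elim (use AB(3) V(3) in blast)
qed

section \<open>The value function and the argmax correspondence\<close>

lemma value_function_eqI:
  assumes "y \<in> T x" and "\<And>y'. y' \<in> T x \<Longrightarrow> f (x, y') \<le> f (x, y)"
  shows "value_function T f x = f (x, y)"
  unfolding value_function_def using assms by (intro Greatest_equality) auto

lemma attains_max_value_functionE:
  assumes "attains_max T f x"
  obtains y where "y \<in> T x" "value_function T f x = f (x, y)"
  using assms value_function_eqI[of _ T x f] unfolding attains_max_def by blast

lemma value_function_upper:
  assumes "attains_max T f x" and "y \<in> T x"
  shows "f (x, y) \<le> value_function T f x"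
  using assms value_function_eqI[of _ T x f] unfolding attains_max_def by metis

lemma upper_pseudo_continuous_attains_max:
  assumes "upper_pseudo_continuous f" and "T x \<noteq> {}" and "compact (T x)"
  shows "attains_max T f x"
  unfolding attains_max_def
  using upper_pseudo_continuous_attains_sup[OF upper_pseudo_continuous_section[OF assms(1)] assms(3,2)] .

lemma upper_pseudo_continuous_value_function:
  assumes "upper_pseudo_continuous f" and "upper_hemicontinuous T"
    and "\<And>x. compact (T x)" and att: "\<And>x. attains_max T f x"
  shows "upper_pseudo_continuous (value_function T f)"
  unfolding upper_pseudo_continuous_def
proof (intro allI impI)
  let ?m = "value_function T f"
  fix x z assume less: "?m x < ?m z"
  obtain w where w: "?m z = f (z, w)"
    using att attains_max_value_functionE by metis
  have "\<forall>\<^sub>F p in nhds (x, y). f p < ?m z" if "y \<in> T x" for y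
  proof -
    have "f (x, y) < f (z, w)"
      using value_function_upper[OF att that] less w by simp
    then show ?thesis
      using assms(1) w by (simp add: upper_pseudo_continuous_def)
  qed
  then have "\<forall>\<^sub>F x' in nhds x. \<forall>y'\<in>T x' - {}. f (x', y') < ?m z"
    using assms(2,3) by (intro upper_hemicontinuous_eventually_Ball) auto
  then show "\<forall>\<^sub>F x' in nhds x. ?m x' < ?m z"
    by eventually_elim (metis Diff_empty att attains_max_value_functionE)
qed

lemma lower_pseudo_continuous_value_function:
  assumes "lower_pseudo_continuous f" and "lower_hemicontinuous T"
    and att: "\<And>x. attains_max T f x"
  shows "lower_pseudo_continuous (value_function T f)"
  unfolding lower_pseudo_continuous_def upper_pseudo_continuous_def neg_less_iff_less
proof (intro allI impI)
  let ?m = "value_function T f"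
  fix x z assume less: "?m z < ?m x"
  obtain w where w: "?m z = f (z, w)"
    using att attains_max_value_functionE by metis
  obtain y where y: "y \<in> T x" "?m x = f (x, y)"
    using att attains_max_value_functionE by metis
  have "\<forall>\<^sub>F p in nhds (x, y). ?m z < f p"
    using lower_pseudo_continuousD[OF assms(1), of "(z, w)" "(x, y)"] less w y by simp
  then have "\<forall>\<^sub>F x' in nhds x. \<exists>y'\<in>T x'. ?m z < f (x', y')"
    by (rule lower_hemicontinuous_eventually_Bex[where P = "\<lambda>p. ?m z < f p", OF assms(2) y(1)])
  then show "\<forall>\<^sub>F x' in nhds x. ?m z < ?m x'"
    by eventually_elim (metis att value_function_upper less_le_trans)
qed

text \<open>
  Both sides of the inequality vary with \<open>x'\<close> here, and \<open>m\<close> need not be continuous.  The comparison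
  with \<open>m x'\<close> goes through points of \<open>T x'\<close> near a maximiser at \<open>x\<close>, at which \<open>f\<close> still exceeds the
  values near \<open>(x, y)\<close>.
\<close>

lemma eventually_less_value_function:
  assumes "pseudo_continuous f" and "lower_hemicontinuous T"
    and att: "\<And>x. attains_max T f x" and less: "f (x, y) < value_function T f x"
  shows "\<forall>\<^sub>F (x', y') in nhds (x, y). f (x', y') < value_function T f x'"
proof -
  obtain w where w: "w \<in> T x" "value_function T f x = f (x, w)"
    using att attains_max_value_functionE by metis
  then have "f (x, y) < f (x, w)" using less by simp
  then obtain P Q where P: "\<forall>\<^sub>F p in nhds (x, y). P p" and Q: "\<forall>\<^sub>F q in nhds (x, w). Q q"
      and PQ: "\<And>p q. P p \<Longrightarrow> Q q \<Longrightarrow> f p < f q"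
    using pseudo_continuous_less_stable[OF assms(1), of "(x, y)" "(x, w)"]
    unfolding eventually_prod_filter case_prod_conv by blast
  have "\<forall>\<^sub>F x' in nhds x. \<exists>w'\<in>T x'. Q (x', w')"
    by (rule lower_hemicontinuous_eventually_Bex[OF assms(2) w(1) Q])
  then have "\<forall>\<^sub>F p in nhds (x, y). \<exists>w'\<in>T (fst p). Q (fst p, w')"
    unfolding nhds_prod by (rule eventually_compose_filterlim) (rule filterlim_fst)
  with P show ?thesis
  proof eventually_elim
    case (elim p)
    then obtain w' where w': "w' \<in> T (fst p)" "Q (fst p, w')" by blast
    have "f p < f (fst p, w')" using PQ elim w' by blast
    also have "\<dots> \<le> value_function T f (fst p)"
      using att w'(1) by (rule value_function_upper)
    finally show ?case by (simp add: case_prod_beta)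
  qed
qed

lemma upper_hemicontinuous_argmax_correspondence:
  assumes "pseudo_continuous f" and "continuous_correspondence T"
    and "\<And>x. compact (T x)" and att: "\<And>x. attains_max T f x"
  shows "upper_hemicontinuous (argmax_correspondence T f)"
  unfolding upper_hemicontinuous_def
proof (intro allI impI)
  let ?m = "value_function T f"
  fix x V assume V: "open V" "argmax_correspondence T f x \<subseteq> V"
  have uhc: "upper_hemicontinuous T" and lhc: "lower_hemicontinuous T"
    using assms(2) by (auto simp: continuous_correspondence_def)
  have "\<forall>\<^sub>F (x', y') in nhds (x, y). f (x', y') < ?m x'" if "y \<in> T x - V" for y
  proof (rule eventually_less_value_function[OF assms(1) lhc att])
    have "f (x, y) \<le> ?m x" using value_function_upper[OF att] that by blast
    moreover have "f (x, y) \<noteq> ?m x"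
      using that V(2) by (auto simp: argmax_correspondence_def)
    ultimately show "f (x, y) < ?m x" by simp
  qed
  then have "\<forall>\<^sub>F x' in nhds x. \<forall>y'\<in>T x' - V. case (x', y') of (x', y') \<Rightarrow> f (x', y') < ?m x'"
    by (rule upper_hemicontinuous_eventually_Ball[OF uhc assms(3) V(1)])
  then show "\<forall>\<^sub>F x' in nhds x. argmax_correspondence T f x' \<subseteq> V"
    by eventually_elim (force simp: argmax_correspondence_def)
qed

theorem theorem3p4:
  fixes T :: "'x::topological_space \<Rightarrow> 'y::topological_space set"
    and f :: "'x \<times> 'y \<Rightarrow> real"
  assumes "pseudo_continuous f"
    and "continuous_correspondence T"
    and "\<And>x. T x \<noteq> {}"
    and "\<And>x. compact (T x)"
  shows "upper_hemicontinuous (argmax_correspondence T f) \<and>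
         (\<forall>x. attains_max T f x) \<and>
         pseudo_continuous (value_function T f)"
proof -
  have upper: "upper_pseudo_continuous f" and lower: "lower_pseudo_continuous f"
    using assms(1) by (auto simp: pseudo_continuous_def)
  have uhc: "upper_hemicontinuous T" and lhc: "lower_hemicontinuous T"
    using assms(2) by (auto simp: continuous_correspondence_def)
  have att: "attains_max T f x" for x
    using upper assms(3,4) by (rule upper_pseudo_continuous_attains_max)
  show ?thesis
    using upper_hemicontinuous_argmax_correspondence[OF assms(1,2,4) att] att
      upper_pseudo_continuous_value_function[OF upper uhc assms(4) att]
      lower_pseudo_continuous_value_function[OF lower lhc att]
    by (simp add: pseudo_continuous_def)
qed

end
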